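(* For any $g\in H^{\infty}$, the integral operator $S_g:\mathcal{B}\to\mathcal{B}$ attains its norm. Furthermore, if $g$ is non-constant, then a function $f\in\mathcal{B}$ with $\|f\|_{\mathcal{B}}=1$ is extremal for the norm of $S_g$ if and only if there exists a sequence $\{z_n\}\subset\mathbb{D}$ with $|z_n|\to1$ such that both $$\lim_{n\to\infty}|g(z_n)|=\sup_{z\in\mathbb{D}}|g(z)|\quad\text{and}\quad\lim_{n\to\infty}(1-|z_n|^2)|f'(z_n)|=1.$$
   Context: $\mathbb{D}$ is the open unit disc in $\mathbb{C}$, $H(\mathbb{D})$ is the space of analytic functions on $\mathbb{D}$, and $H^\infty$ is the set of bounded functions in $H(\mathbb{D})$. For $g\in H(\mathbb{D})$, the operator $S_g$ is defined on $H(\mathbb{D})$ by $S_gf(z)=\int_0^z f'(w)g(w)\,dw$. The Bloch space $\mathcal{B}$ is the Banach space of all $f\in H(\mathbb{D})$ with $\|f\|_{\mathcal{B}}=|f(0)|+\sup_{z\in\mathbb{D}}(1-|z|^2)|f'(z)|<\infty$. It is known that $S_g$ is bounded on $\mathcal{B}$ if and only if $g\in H^\infty$. A bounded linear operator $T:X\to Y$ between Banach spaces attains its norm (is norm-attaining) if there is $x\in X$ with $\|x\|=1$ and $\|Tx\|=\|T\|$, where $\|T\|$ is the operator norm; such an $x$ is called extremal for the norm of $T$. *)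

theory Defs
  imports "HOL-Complex_Analysis.Complex_Analysis"
begin

abbreviation unit_disc :: "complex set" ("\<DD>") where
  "\<DD> \<equiv> ball 0 1"

definition H_infinity :: "(complex \<Rightarrow> complex) set" where
  "H_infinity = {g. g holomorphic_on \<DD> \<and> bounded (g ` \<DD>)}"

definition bloch_weight :: "(complex \<Rightarrow> complex) \<Rightarrow> complex \<Rightarrow> real" where
  "bloch_weight f z = (1 - (cmod z)\<^sup>2) * cmod (deriv f z)"

definition bloch_fun_norm :: "(complex \<Rightarrow> complex) \<Rightarrow> real" where
  "bloch_fun_norm f = cmod (f 0) + (SUP z\<in>\<DD>. bloch_weight f z)"

text \<open>
  Functions in HOL are total, so an element of the Bloch space (a function on the unit disc) is
  represented by its extension by zero outside the disc. This makes extensional equality coincide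
  with equality on the disc, so that the Bloch norm is a norm on the type below.
\<close>

typedef bloch = "{f :: complex \<Rightarrow> complex.
    f holomorphic_on \<DD> \<and> bdd_above (bloch_weight f ` \<DD>) \<and> (\<forall>z. z \<notin> \<DD> \<longrightarrow> f z = 0)}"
  morphisms bloch_fun Abs_bloch
  by (rule exI[of _ "\<lambda>_. 0"]) (auto simp: bloch_weight_def)

setup_lifting type_definition_bloch

definition disc_restrict :: "(complex \<Rightarrow> complex) \<Rightarrow> complex \<Rightarrow> complex" where
  "disc_restrict f z = (if z \<in> \<DD> then f z else 0)"

lemma bloch_weight_cong:
  assumes "\<And>z. z \<in> \<DD> \<Longrightarrow> f z = g z" "z \<in> \<DD>"
  shows "bloch_weight f z = bloch_weight g z"
proof -
  have "\<forall>\<^sub>F w in nhds z. w \<in> \<DD>"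
    using assms(2) by (intro eventually_nhds_in_open) auto
  hence "\<forall>\<^sub>F w in nhds z. f w = g w"
    by eventually_elim (use assms(1) in auto)
  thus ?thesis by (simp add: bloch_weight_def deriv_cong_ev)
qed

lemma bloch_fun_Abs_bloch_restrict:
  assumes "f holomorphic_on \<DD>" "bdd_above (bloch_weight f ` \<DD>)"
  shows "bloch_fun (Abs_bloch (disc_restrict f)) = disc_restrict f"
proof (rule Abs_bloch_inverse, safe)
  show "disc_restrict f holomorphic_on \<DD>"
    using assms(1) by (rule holomorphic_transform) (simp add: disc_restrict_def)
  have "bloch_weight (disc_restrict f) ` \<DD> = bloch_weight f ` \<DD>"
    by (intro image_cong refl bloch_weight_cong) (auto simp: disc_restrict_def)
  thus "bdd_above (bloch_weight (disc_restrict f) ` \<DD>)"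
    using assms(2) by simp
qed (auto simp: disc_restrict_def)

lemma bloch_weight_nonneg: "z \<in> \<DD> \<Longrightarrow> 0 \<le> bloch_weight f z"
  by (auto simp: bloch_weight_def power_le_one)

lemma bloch_weight_zero [simp]: "bloch_weight (\<lambda>_. 0) z = 0"
  by (simp add: bloch_weight_def)

lemma deriv_disc_add:
  assumes "f holomorphic_on \<DD>" "g holomorphic_on \<DD>" "z \<in> \<DD>"
  shows "deriv (\<lambda>x. f x + g x) z = deriv f z + deriv g z"
  by (intro deriv_add holomorphic_on_imp_differentiable_at[OF assms(1) open_ball assms(3)]
      holomorphic_on_imp_differentiable_at[OF assms(2) open_ball assms(3)])

lemma bloch_weight_add:
  assumes "f holomorphic_on \<DD>" "g holomorphic_on \<DD>" "z \<in> \<DD>"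
  shows "bloch_weight (\<lambda>x. f x + g x) z \<le> bloch_weight f z + bloch_weight g z"
proof -
  have "0 \<le> 1 - (cmod z)\<^sup>2"
    using assms(3) by (auto simp: power_le_one)
  hence "(1 - (cmod z)\<^sup>2) * cmod (deriv f z + deriv g z)
       \<le> (1 - (cmod z)\<^sup>2) * (cmod (deriv f z) + cmod (deriv g z))"
    by (intro mult_left_mono norm_triangle_ineq)
  thus ?thesis
    using deriv_disc_add[OF assms] by (simp add: bloch_weight_def algebra_simps)
qed

lemma bloch_weight_scaleR:
  assumes "f holomorphic_on \<DD>" "z \<in> \<DD>"
  shows "bloch_weight (\<lambda>x. r *\<^sub>R f x) z = \<bar>r\<bar> * bloch_weight f z"
proof -
  have "deriv (\<lambda>x. of_real r * f x) z = of_real r * deriv f z"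
    by (rule deriv_cmult[OF holomorphic_on_imp_differentiable_at[OF assms(1) open_ball assms(2)]])
  thus ?thesis by (simp add: bloch_weight_def scaleR_conv_of_real norm_mult)
qed

lemma bdd_above_weight_add:
  assumes "f holomorphic_on \<DD>" "g holomorphic_on \<DD>"
    "bdd_above (bloch_weight f ` \<DD>)" "bdd_above (bloch_weight g ` \<DD>)"
  shows "bdd_above (bloch_weight (\<lambda>x. f x + g x) ` \<DD>)"
proof -
  obtain A B where "\<And>z. z \<in> \<DD> \<Longrightarrow> bloch_weight f z \<le> A" "\<And>z. z \<in> \<DD> \<Longrightarrow> bloch_weight g z \<le> B"
    using assms(3,4) unfolding bdd_above_def by blast
  thus ?thesis
    using bloch_weight_add[OF assms(1,2)]
    by (intro bdd_aboveI2[of _ _ "A + B"]) (meson add_mono order_trans)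
qed

lemma bdd_above_weight_scaleR:
  assumes "f holomorphic_on \<DD>" "bdd_above (bloch_weight f ` \<DD>)"
  shows "bdd_above (bloch_weight (\<lambda>x. r *\<^sub>R f x) ` \<DD>)"
proof -
  obtain A where "\<And>z. z \<in> \<DD> \<Longrightarrow> bloch_weight f z \<le> A"
    using assms(2) unfolding bdd_above_def by blast
  thus ?thesis
    by (intro bdd_aboveI2[of _ _ "\<bar>r\<bar> * A"]) (simp add: bloch_weight_scaleR[OF assms(1)] mult_left_mono)
qed

instantiation bloch :: real_normed_vector
begin

lift_definition zero_bloch :: bloch is "\<lambda>_. 0"
  by (auto simp: bloch_weight_def)

lift_definition plus_bloch :: "bloch \<Rightarrow> bloch \<Rightarrow> bloch" is "\<lambda>f g z. f z + g z"
  by (auto intro: holomorphic_intros bdd_above_weight_add)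

lift_definition scaleR_bloch :: "real \<Rightarrow> bloch \<Rightarrow> bloch" is "\<lambda>r f z. r *\<^sub>R f z"
  by (auto intro: bdd_above_weight_scaleR simp: scaleR_conv_of_real intro!: holomorphic_intros)
     (auto simp: scaleR_conv_of_real[symmetric] intro: bdd_above_weight_scaleR)

definition uminus_bloch :: "bloch \<Rightarrow> bloch" where
  "uminus_bloch f = (-1) *\<^sub>R f"

definition minus_bloch :: "bloch \<Rightarrow> bloch \<Rightarrow> bloch" where
  "minus_bloch f g = f + - g"

definition norm_bloch :: "bloch \<Rightarrow> real" where
  "norm_bloch f = bloch_fun_norm (bloch_fun f)"

definition dist_bloch :: "bloch \<Rightarrow> bloch \<Rightarrow> real" where
  "dist_bloch f g = norm (f - g)"

definition sgn_bloch :: "bloch \<Rightarrow> bloch" where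
  "sgn_bloch f = inverse (norm f) *\<^sub>R f"

definition uniformity_bloch :: "(bloch \<times> bloch) filter" where
  "uniformity_bloch = (INF e\<in>{0 <..}. principal {(x, y). dist x y < e})"

definition open_bloch :: "bloch set \<Rightarrow> bool" where
  "open_bloch S = (\<forall>x\<in>S. \<forall>\<^sub>F (x', y) in uniformity. x' = x \<longrightarrow> y \<in> S)"

lemma bloch_fun_props:
  "bloch_fun f holomorphic_on \<DD>" "bdd_above (bloch_weight (bloch_fun f) ` \<DD>)"
  "z \<notin> \<DD> \<Longrightarrow> bloch_fun f z = 0"
  using bloch_fun[of f] by auto

lemma bloch_weight_le_Sup:
  "z \<in> \<DD> \<Longrightarrow> bloch_weight (bloch_fun f) z \<le> (SUP z\<in>\<DD>. bloch_weight (bloch_fun f) z)"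
  by (intro cSUP_upper bloch_fun_props)

lemma bloch_Sup_nonneg: "0 \<le> (SUP z\<in>\<DD>. bloch_weight (bloch_fun f) z)"
  using bloch_weight_le_Sup[of 0 f] bloch_weight_nonneg[of 0 "bloch_fun f"] by simp

lemma bloch_norm_zero_imp:
  assumes "norm f = 0"
  shows "f = (0 :: bloch)"
proof -
  let ?f = "bloch_fun f"
  have f0: "?f 0 = 0" and S: "(SUP z\<in>\<DD>. bloch_weight ?f z) = 0"
    using assms bloch_Sup_nonneg[of f]
    by (auto simp: norm_bloch_def bloch_fun_norm_def add_nonneg_eq_0_iff)
  have d: "(?f has_field_derivative 0) (at z within \<DD>)" if "z \<in> \<DD>" for z
  proof -
    have "bloch_weight ?f z = 0"
      using bloch_weight_le_Sup[OF that, of f] bloch_weight_nonneg[OF that, of ?f] S by simp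
    moreover have "(cmod z)\<^sup>2 < 1"
      using that by (simp add: abs_square_less_1)
    ultimately have "deriv ?f z = 0"
      by (simp add: bloch_weight_def)
    thus ?thesis
      using holomorphic_derivI[OF bloch_fun_props(1) open_ball that, of f] by (metis has_field_derivative_at_within)
  qed
  have "?f z = 0" for z
  proof (cases "z \<in> \<DD>")
    case True
    obtain c where "\<And>z. z \<in> \<DD> \<Longrightarrow> ?f z = c"
      using has_field_derivative_zero_constant[of \<DD> ?f] d by (metis convex_ball)
    thus ?thesis using f0 True by (metis centre_in_ball zero_less_one)
  qed (rule bloch_fun_props)
  thus ?thesis
    by (intro iffD1[OF bloch_fun_inject]) (auto simp: zero_bloch.rep_eq)
qed

instance
proof
  fix f g h :: bloch and a b :: real
  show "f + g + h = f + (g + h)" "f + g = g + f" "0 + f = f"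
    by (transfer, simp add: algebra_simps)+
  show "- f + f = 0" unfolding uminus_bloch_def by transfer simp
  show "f - g = f + - g" by (simp add: minus_bloch_def)
  show "a *\<^sub>R (f + g) = a *\<^sub>R f + a *\<^sub>R g" "(a + b) *\<^sub>R f = a *\<^sub>R f + b *\<^sub>R f"
    "a *\<^sub>R b *\<^sub>R f = (a * b) *\<^sub>R f" "1 *\<^sub>R f = f"
    by (transfer, simp add: algebra_simps)+
  show "sgn f = inverse (norm f) *\<^sub>R f" by (simp add: sgn_bloch_def)
  show "dist f g = norm (f - g)" by (simp add: dist_bloch_def)
  show "uniformity = (INF e\<in>{0 <..}. principal {(x, y :: bloch). dist x y < e})"
    by (simp add: uniformity_bloch_def)
  show "open S = (\<forall>x\<in>S. \<forall>\<^sub>F (x', y) in uniformity. x' = x \<longrightarrow> y \<in> S)" for S :: "bloch set"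
    by (simp add: open_bloch_def)
  show "norm f = 0 \<longleftrightarrow> f = 0"
    using bloch_norm_zero_imp[of f]
    by (auto simp: norm_bloch_def bloch_fun_norm_def zero_bloch.rep_eq)
  show "norm (f + g) \<le> norm f + norm g"
  proof -
    have "(SUP z\<in>\<DD>. bloch_weight (bloch_fun (f + g)) z)
        \<le> (SUP z\<in>\<DD>. bloch_weight (bloch_fun f) z) + (SUP z\<in>\<DD>. bloch_weight (bloch_fun g) z)"
    proof (rule cSUP_least)
      fix z assume z: "z \<in> \<DD>"
      show "bloch_weight (bloch_fun (f + g)) z
         \<le> (SUP z\<in>\<DD>. bloch_weight (bloch_fun f) z) + (SUP z\<in>\<DD>. bloch_weight (bloch_fun g) z)"
        using bloch_weight_add[OF bloch_fun_props(1) bloch_fun_props(1) z, of f g]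
          bloch_weight_le_Sup[OF z, of f] bloch_weight_le_Sup[OF z, of g]
        by (simp add: plus_bloch.rep_eq)
    qed simp
    thus ?thesis
      using norm_triangle_ineq[of "bloch_fun f 0" "bloch_fun g 0"]
      by (simp add: norm_bloch_def bloch_fun_norm_def plus_bloch.rep_eq)
  qed
  have scale_le: "norm (c *\<^sub>R k) \<le> \<bar>c\<bar> * norm k" for c :: real and k :: bloch
  proof -
    have "(SUP z\<in>\<DD>. bloch_weight (bloch_fun (c *\<^sub>R k)) z)
        \<le> \<bar>c\<bar> * (SUP z\<in>\<DD>. bloch_weight (bloch_fun k) z)"
    proof (rule cSUP_least)
      fix z assume z: "z \<in> \<DD>"
      show "bloch_weight (bloch_fun (c *\<^sub>R k)) z \<le> \<bar>c\<bar> * (SUP z\<in>\<DD>. bloch_weight (bloch_fun k) z)"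
        using bloch_weight_scaleR[OF bloch_fun_props(1) z, of c k] bloch_weight_le_Sup[OF z, of k]
        by (simp add: scaleR_bloch.rep_eq mult_left_mono)
    qed simp
    thus ?thesis
      by (simp add: norm_bloch_def bloch_fun_norm_def scaleR_bloch.rep_eq distrib_left)
  qed
  show "norm (a *\<^sub>R f) = \<bar>a\<bar> * norm f"
  proof (cases "a = 0")
    case True
    have "0 *\<^sub>R f = 0" by transfer simp
    with True show ?thesis
      by (simp add: norm_bloch_def bloch_fun_norm_def zero_bloch.rep_eq)
  next
    case False
    have "inverse a *\<^sub>R (a *\<^sub>R f) = f"
      using False by transfer simp
    hence "norm f \<le> \<bar>inverse a\<bar> * norm (a *\<^sub>R f)"
      using scale_le[of "inverse a" "a *\<^sub>R f"] by simp
    hence "\<bar>a\<bar> * norm f \<le> norm (a *\<^sub>R f)"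
      using False by (simp add: field_simps)
    thus ?thesis using scale_le[of a f] by simp
  qed
qed

end

definition integral_op :: "(complex \<Rightarrow> complex) \<Rightarrow> (complex \<Rightarrow> complex) \<Rightarrow> complex \<Rightarrow> complex" where
  "integral_op g f z = contour_integral (linepath 0 z) (\<lambda>w. deriv f w * g w)"

text \<open>
  The operator on the Bloch space induced by \<^const>\<open>integral_op\<close>. It is meaningful when the
  image lies in the Bloch space, which is the case for every symbol in \<^const>\<open>H_infinity\<close>: see
  \<open>bloch_fun_bloch_op\<close> below.
\<close>

definition bloch_op :: "(complex \<Rightarrow> complex) \<Rightarrow> bloch \<Rightarrow> bloch" where
  "bloch_op g f = Abs_bloch (disc_restrict (integral_op g (bloch_fun f)))"

lemma integral_op_has_field_derivative:
  assumes f: "f holomorphic_on \<DD>" and g: "g holomorphic_on \<DD>" and z: "z \<in> \<DD>"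
  shows "(integral_op g f has_field_derivative deriv f z * g z) (at z)"
proof -
  have "(\<lambda>w. deriv f w * g w) holomorphic_on \<DD>"
    by (intro holomorphic_on_mult holomorphic_deriv f g open_ball)
  then obtain F where F: "\<And>x. x \<in> \<DD> \<Longrightarrow> (F has_field_derivative deriv f x * g x) (at x within \<DD>)"
    using holomorphic_convex_primitive'[OF convex_ball open_ball] by blast
  have eq: "integral_op g f w = F w - F 0" if w: "w \<in> \<DD>" for w
  proof -
    have "path_image (linepath 0 w) \<subseteq> \<DD>"
      using w by (simp add: closed_segment_subset)
    hence "((\<lambda>x. deriv f x * g x) has_contour_integral (F (pathfinish (linepath 0 w)) - F (pathstart (linepath 0 w))))
        (linepath 0 w)"
      using contour_integral_primitive[OF F valid_path_linepath] by blast
    thus ?thesis by (simp add: integral_op_def contour_integral_unique)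
  qed
  have "((\<lambda>w. F w - F 0) has_field_derivative deriv f z * g z) (at z)"
    using DERIV_diff[OF F[OF z] DERIV_const, of "F 0"]
    unfolding at_within_open[OF z open_ball] diff_zero .
  thus ?thesis
    by (rule has_field_derivative_transform_within_open[OF _ open_ball z]) (rule eq[symmetric])
qed

lemma bloch_fun_bloch_op:
  assumes g: "g \<in> H_infinity"
  shows "bloch_fun (bloch_op g f) = disc_restrict (integral_op g (bloch_fun f))"
  unfolding bloch_op_def
proof (rule bloch_fun_Abs_bloch_restrict)
  let ?f = "bloch_fun f"
  have gh: "g holomorphic_on \<DD>" using g by (simp add: H_infinity_def)
  note D = integral_op_has_field_derivative[OF bloch_fun_props(1) gh, of _ f]
  show "integral_op g ?f holomorphic_on \<DD>"
    unfolding holomorphic_on_def field_differentiable_def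
    using D by (blast intro: has_field_derivative_at_within)
  obtain M where M: "\<And>z. z \<in> \<DD> \<Longrightarrow> cmod (g z) \<le> M"
    using g unfolding H_infinity_def bounded_iff by blast
  have "bloch_weight (integral_op g ?f) z \<le> (SUP z\<in>\<DD>. bloch_weight ?f z) * M" if z: "z \<in> \<DD>" for z
  proof -
    have "bloch_weight (integral_op g ?f) z = bloch_weight ?f z * cmod (g z)"
      using DERIV_imp_deriv[OF D[OF z]] by (simp add: bloch_weight_def norm_mult)
    also have "\<dots> \<le> (SUP z\<in>\<DD>. bloch_weight ?f z) * M"
      using M[OF z] bloch_weight_le_Sup[OF z, of f] bloch_Sup_nonneg[of f] by (intro mult_mono) auto
    finally show ?thesis .
  qed
  thus "bdd_above (bloch_weight (integral_op g ?f) ` \<DD>)"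
    by (rule bdd_aboveI2)
qed

definition extremal :: "('a::real_normed_vector \<Rightarrow> 'b::real_normed_vector) \<Rightarrow> 'a \<Rightarrow> bool" where
  "extremal T x \<longleftrightarrow> norm x = 1 \<and> norm (T x) = onorm T"

text \<open>
  Boundedness is part of the definition; for an unbounded operator \<^const>\<open>onorm\<close> is a supremum
  of an unbounded set of reals and carries no meaning.
\<close>

definition norm_attaining :: "('a::real_normed_vector \<Rightarrow> 'b::real_normed_vector) \<Rightarrow> bool" where
  "norm_attaining T \<longleftrightarrow> bounded_linear T \<and> (\<exists>x. extremal T x)"

end

theory Submission
  imports Defs
begin

text \<open>
  Write \<open>w\<^sub>f z = (1 - |z|\<^sup>2) |f' z|\<close> for the Bloch weight and \<open>M\<close> for the supremum of \<open>|g|\<close> on the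
  disc. Since \<open>S\<^sub>g f\<close> vanishes at the origin and has derivative \<open>f' g\<close>, its norm is the supremum of
  \<open>w\<^sub>f |g|\<close>, which is at most \<open>M\<close> when \<open>f\<close> has norm 1.

  The bound is attained by a bounded function. By the maximum principle there are points
  \<open>z\<^sub>n\<close> with \<open>|z\<^sub>n| \<rightarrow> 1\<close> and \<open>|g z\<^sub>n| \<rightarrow> M\<close>. A subsequence of them, still called \<open>z\<^sub>n\<close>, is so sparse in
  the pseudohyperbolic metric that the finite Blaschke products with zeros \<open>z\<^sub>0, \<dots>, z\<^sub>N\<close> have
  weight at least \<open>1 - 2 / 2\<^sup>n\<close> at \<open>z\<^sub>n\<close>, uniformly in \<open>N \<ge> n\<close> (\<open>bloch_weight_finite_Blaschke_lower\<close>).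
  Montel's theorem provides a limit \<open>B\<close> with \<open>|B| \<le> 1\<close> and the same lower bounds
  (\<open>exists_bounded_with_bloch_weight_tendsto_1\<close>), while the Schwarz--Pick inequality
  (\<open>bloch_weight_le_1\<close>) gives \<open>w\<^sub>B \<le> 1\<close>. Hence \<open>B - B 0\<close> has Bloch norm 1, and its image under \<open>S\<^sub>g\<close> has norm at
  least \<open>lim w\<^sub>B z\<^sub>n |g z\<^sub>n| = M\<close>; in particular \<open>M\<close> is the operator norm.

  For the description of the extremal functions, \<open>w\<^sub>f \<le> 1\<close> and \<open>|g| \<le> M\<close>, so that
  \<open>w\<^sub>f z\<^sub>n |g z\<^sub>n| \<rightarrow> M > 0\<close> holds exactly when both factors tend to their upper bounds; and when \<open>g\<close> is
  not constant, the maximum principle forces \<open>|z\<^sub>n| \<rightarrow> 1\<close> as soon as \<open>|g z\<^sub>n| \<rightarrow> M\<close>.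
\<close>

section \<open>Disc automorphisms and the Schwarz--Pick inequality\<close>

lemma one_minus_cnj_mult_nonzero:
  assumes "cmod a < 1" "cmod z < 1"
  shows "1 - cnj a * z \<noteq> 0"
proof
  assume "1 - cnj a * z = 0"
  hence "cmod (cnj a * z) = 1" by simp
  moreover have "cmod (cnj a * z) < 1"
    using norm_mult_less[of "cnj a" 1 z 1] assms by simp
  ultimately show False by simp
qed

lemma one_minus_norm_Moebius_sq:
  assumes "cmod a < 1" "cmod z < 1"
  shows "1 - (cmod (Moebius_function 0 a z))\<^sup>2
       = (1 - (cmod a)\<^sup>2) * (1 - (cmod z)\<^sup>2) / (cmod (1 - cnj a * z))\<^sup>2"
proof -
  have "(cmod (1 - cnj a * z))\<^sup>2 - (cmod (z - a))\<^sup>2 = (1 - (cmod a)\<^sup>2) * (1 - (cmod z)\<^sup>2)"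
    by (simp add: cmod_power2) (simp add: algebra_simps power2_eq_square)
  thus ?thesis
    using one_minus_cnj_mult_nonzero[OF assms]
    by (simp add: Moebius_function_simple norm_divide power_divide field_simps)
qed

lemma norm_Moebius_commute: "cmod (Moebius_function 0 a z) = cmod (Moebius_function 0 z a)"
proof -
  have "cmod (1 - cnj a * z) = cmod (cnj (1 - cnj a * z))"
    by (rule complex_mod_cnj[symmetric])
  thus ?thesis
    by (simp add: Moebius_function_simple norm_divide norm_minus_commute mult.commute)
qed

lemma norm_Moebius_tendsto_1:
  assumes a: "cmod a < 1" and z: "\<And>n. cmod (z n) < 1" and lim: "(\<lambda>n. cmod (z n)) \<longlonglongrightarrow> 1"
  shows "(\<lambda>n. cmod (Moebius_function 0 a (z n))) \<longlonglongrightarrow> 1"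
proof -
  let ?\<phi> = "\<lambda>n. cmod (Moebius_function 0 a (z n))"
  have "(\<lambda>n. 1 - (?\<phi> n)\<^sup>2) \<longlonglongrightarrow> 0"
  proof (rule tendsto_sandwich)
    show "\<forall>\<^sub>F n in sequentially. 0 \<le> 1 - (?\<phi> n)\<^sup>2"
      using Moebius_function_norm_lt_1[OF a z, of 0]
      by (intro always_eventually allI) (simp add: power_le_one less_imp_le)
    show "\<forall>\<^sub>F n in sequentially. 1 - (?\<phi> n)\<^sup>2 \<le> (1 - (cmod a)\<^sup>2) * (1 - (cmod (z n))\<^sup>2) / (1 - cmod a)\<^sup>2"
    proof (intro always_eventually allI)
      fix n
      have "cmod (cnj a * z n) \<le> cmod a * 1"
        unfolding norm_mult complex_mod_cnj using z[of n] by (intro mult_left_mono) auto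
      hence "1 - cmod a \<le> cmod (1 - cnj a * z n)"
        using norm_triangle_ineq2[of 1 "cnj a * z n"] by simp
      hence "(1 - cmod a)\<^sup>2 \<le> (cmod (1 - cnj a * z n))\<^sup>2"
        using a by (intro power_mono) auto
      moreover have "0 \<le> (1 - (cmod a)\<^sup>2) * (1 - (cmod (z n))\<^sup>2)"
        using a z[of n] by (intro mult_nonneg_nonneg) (auto simp: power_le_one less_imp_le)
      ultimately show "1 - (?\<phi> n)\<^sup>2 \<le> (1 - (cmod a)\<^sup>2) * (1 - (cmod (z n))\<^sup>2) / (1 - cmod a)\<^sup>2"
        unfolding one_minus_norm_Moebius_sq[OF a z] using a
        by (intro divide_left_mono mult_pos_pos) (auto simp: one_minus_cnj_mult_nonzero[OF a z])
    qed
    have "(\<lambda>n. (1 - (cmod a)\<^sup>2) * (1 - (cmod (z n))\<^sup>2) / (1 - cmod a)\<^sup>2)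
        \<longlonglongrightarrow> (1 - (cmod a)\<^sup>2) * (1 - 1\<^sup>2) / (1 - cmod a)\<^sup>2"
      using a by (intro tendsto_intros lim) auto
    thus "(\<lambda>n. (1 - (cmod a)\<^sup>2) * (1 - (cmod (z n))\<^sup>2) / (1 - cmod a)\<^sup>2) \<longlonglongrightarrow> 0" by simp
  qed simp
  hence "(\<lambda>n. sqrt (1 - (1 - (?\<phi> n)\<^sup>2))) \<longlonglongrightarrow> sqrt (1 - 0)"
    by (intro tendsto_intros)
  thus ?thesis by simp
qed

lemma Moebius_has_field_derivative:
  assumes "1 - cnj a * z \<noteq> 0"
  shows "(Moebius_function 0 a has_field_derivative (1 - (cmod a)\<^sup>2) / (1 - cnj a * z)\<^sup>2) (at z)"
proof -
  have "((\<lambda>z. (z - a) / (1 - cnj a * z)) has_field_derivative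
      (1 * (1 - cnj a * z) - (z - a) * (- cnj a)) / ((1 - cnj a * z) * (1 - cnj a * z))) (at z)"
    using assms by (auto intro!: derivative_eq_intros)
  moreover have "1 * (1 - cnj a * z) - (z - a) * (- cnj a) = 1 - (of_real (cmod a))\<^sup>2"
    using complex_norm_square[of a] by (simp add: algebra_simps)
  ultimately show ?thesis
    unfolding Moebius_function_simple[abs_def] power2_eq_square[of "1 - cnj a * z"]
    by (simp only: of_real_diff of_real_1 of_real_power)
qed

text \<open>
  The Schwarz--Pick inequality at \<open>a\<close>: the automorphism taking \<open>0\<close> to \<open>a\<close> turns the weight into the
  modulus of a derivative at the origin, which Cauchy's inequality on circles of radius \<open>r < 1\<close>
  bounds by \<open>1 / r\<close>.
\<close>

lemma bloch_weight_le_1: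
  assumes f: "f holomorphic_on \<DD>" and f1: "\<And>z. z \<in> \<DD> \<Longrightarrow> cmod (f z) \<le> 1" and a: "a \<in> \<DD>"
  shows "bloch_weight f a \<le> 1"
proof -
  let ?\<phi> = "Moebius_function 0 (- a)"
  have a1: "cmod a < 1" using a by simp
  have \<phi>: "?\<phi> holomorphic_on \<DD>" "?\<phi> ` \<DD> \<subseteq> \<DD>" "?\<phi> 0 = a"
    using a1 Moebius_function_holomorphic[of "- a" 0] Moebius_function_norm_lt_1[of "- a" _ 0]
    by (auto simp: Moebius_function_of_zero)
  have F: "(f \<circ> ?\<phi>) holomorphic_on \<DD>"
    using \<phi> f by (auto intro: holomorphic_on_compose_gen)
  have "(?\<phi> has_field_derivative complex_of_real (1 - (cmod a)\<^sup>2)) (at 0)"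
    using Moebius_has_field_derivative[of "- a" 0] by simp
  hence "(f \<circ> ?\<phi> has_field_derivative deriv f a * complex_of_real (1 - (cmod a)\<^sup>2)) (at 0)"
    by (intro DERIV_chain) (use holomorphic_derivI[OF f open_ball a] in \<open>simp_all add: \<phi>\<close>)
  hence D: "deriv (f \<circ> ?\<phi>) 0 = deriv f a * complex_of_real (1 - (cmod a)\<^sup>2)"
    by (rule DERIV_imp_deriv)
  have "0 \<le> 1 - (cmod a)\<^sup>2"
    using a1 by (simp add: power_le_one)
  hence D: "cmod (deriv (f \<circ> ?\<phi>) 0) = bloch_weight f a"
    unfolding D bloch_weight_def norm_mult norm_of_real by simp
  have "r * bloch_weight f a \<le> 1" if r: "0 < r" "r < 1" for r
  proof -
    have sub: "cball 0 r \<subseteq> \<DD>" using r by auto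
    have "cmod ((deriv ^^ 1) (f \<circ> ?\<phi>) 0) \<le> fact 1 * 1 / r ^ 1"
    proof (rule Cauchy_inequality)
      show "f \<circ> ?\<phi> holomorphic_on ball 0 r"
        by (rule holomorphic_on_subset[OF F]) (use r in auto)
      show "continuous_on (cball 0 r) (f \<circ> ?\<phi>)"
        by (intro holomorphic_on_imp_continuous_on holomorphic_on_subset[OF F] sub)
      show "cmod ((f \<circ> ?\<phi>) x) \<le> 1" if "cmod (0 - x) = r" for x
      proof -
        have "x \<in> \<DD>" using that r by simp
        hence "?\<phi> x \<in> \<DD>" using \<phi>(2) by blast
        thus ?thesis using f1 by simp
      qed
    qed (use r in auto)
    thus ?thesis using D r by (simp add: field_simps)
  qed
  thus ?thesis by (rule field_le_mult_one_interval)
qed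

section \<open>Blaschke products with sparse zeros\<close>

text \<open>
  At a zero \<open>a n\<close> only the derivative of the factor vanishing there contributes, and its modulus
  \<open>1 / (1 - |a n|\<^sup>2)\<close> cancels the weight.
\<close>

lemma bloch_weight_finite_Blaschke:
  assumes a: "\<And>k. k \<in> A \<Longrightarrow> cmod (a k) < 1" and A: "finite A" "n \<in> A"
  shows "bloch_weight (\<lambda>z. \<Prod>k\<in>A. Moebius_function 0 (a k) z) (a n)
       = (\<Prod>k\<in>A - {n}. cmod (Moebius_function 0 (a k) (a n)))"
proof -
  let ?Q = "\<lambda>z. \<Prod>k\<in>A - {n}. Moebius_function 0 (a k) z"
  let ?d = "complex_of_real (1 - (cmod (a n))\<^sup>2)"
  have an: "cmod (a n) < 1" using a A by blast
  hence sq: "(cmod (a n))\<^sup>2 < 1" by (simp add: abs_square_less_1)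
  have Q: "?Q holomorphic_on \<DD>"
    by (intro holomorphic_on_prod Moebius_function_holomorphic) (use a in auto)
  have eq: "(\<lambda>z. \<Prod>k\<in>A. Moebius_function 0 (a k) z) = (\<lambda>z. Moebius_function 0 (a n) z * ?Q z)"
    using A by (auto simp: prod.remove)
  have cn: "1 - cnj (a n) * a n = ?d"
    by (simp add: complex_norm_square mult.commute flip: of_real_power)
  have "(Moebius_function 0 (a n) has_field_derivative 1 / ?d) (at (a n))"
    using Moebius_has_field_derivative[OF one_minus_cnj_mult_nonzero[OF an an]] sq
    unfolding cn by (simp add: power2_eq_square del: of_real_mult)
  from DERIV_mult[OF this holomorphic_derivI[OF Q open_ball]] an
  have "deriv (\<lambda>z. Moebius_function 0 (a n) z * ?Q z) (a n) = ?Q (a n) / ?d"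
    by (intro DERIV_imp_deriv) (simp add: Moebius_function_eq_zero)
  moreover have "cmod ?d = 1 - (cmod (a n))\<^sup>2"
    using sq by (simp only: norm_of_real abs_of_pos diff_gt_0_iff_gt)
  ultimately show ?thesis
    using sq unfolding bloch_weight_def eq by (simp add: norm_divide prod_norm del: of_real_diff)
qed

lemma bloch_weight_finite_Blaschke_lower:
  assumes a: "\<And>k. cmod (a k) < 1"
    and sparse: "\<And>j k. j < k \<Longrightarrow> 1 - (1/4) ^ k \<le> cmod (Moebius_function 0 (a j) (a k))"
    and n: "n < N"
  shows "1 - 2 * (1/2) ^ n \<le> bloch_weight (\<lambda>z. \<Prod>k<N. Moebius_function 0 (a k) z) (a n)"
proof -
  let ?\<rho> = "\<lambda>k. cmod (Moebius_function 0 (a k) (a n))"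
  have low: "1 - ?\<rho> k \<le> (1/2) ^ n * (1/2) ^ k" if "k \<noteq> n" for k
  proof -
    \<comment> \<open>The error \<open>(1/4) ^ max n k\<close> is split so that it is summable over \<open>k\<close> and still decays in \<open>n\<close>.\<close>
    have *: "(1/4 :: real) ^ max n k \<le> (1/2) ^ n * (1/2) ^ k"
    proof -
      have "(1/4 :: real) ^ max n k = ((1/2)\<^sup>2) ^ max n k" by (simp add: power2_eq_square)
      also have "\<dots> = (1/2) ^ (2 * max n k)" by (simp only: power_mult)
      also have "\<dots> \<le> (1/2) ^ (n + k)" by (rule power_decreasing) auto
      finally show ?thesis by (simp add: power_add)
    qed
    have "1 - (1/4) ^ max n k \<le> ?\<rho> k"
      using sparse[of k n] sparse[of n k] that norm_Moebius_commute[of "a k" "a n"]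
      by (cases "k < n") (auto simp: max_def)
    with * show ?thesis by linarith
  qed
  have "(\<Sum>k\<in>{..<N} - {n}. 1 - ?\<rho> k) \<le> (\<Sum>k\<in>{..<N} - {n}. (1/2) ^ n * (1/2) ^ k)"
    by (intro sum_mono low) auto
  also have "\<dots> \<le> (\<Sum>k<N. (1/2) ^ n * (1/2) ^ k)"
    by (intro sum_mono2) auto
  also have "\<dots> = (1/2) ^ n * (\<Sum>k<N. (1/2) ^ k)"
    by (simp add: sum_distrib_left)
  also have "\<dots> \<le> (1/2) ^ n * 2"
    using geometric_sum[of "1/2 :: real" N] by (intro mult_left_mono) auto
  finally have "1 - 2 * (1/2) ^ n \<le> 1 - (\<Sum>k\<in>{..<N} - {n}. 1 - ?\<rho> k)"
    by simp
  also have "\<dots> \<le> (\<Prod>k\<in>{..<N} - {n}. 1 - (1 - ?\<rho> k))"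
    using Moebius_function_norm_lt_1[OF a a, of 0]
    by (intro Weierstrass_prod_ineq) (auto intro: less_imp_le)
  also have "\<dots> = bloch_weight (\<lambda>z. \<Prod>k<N. Moebius_function 0 (a k) z) (a n)"
    using n a by (subst bloch_weight_finite_Blaschke) auto
  finally show ?thesis .
qed

lemma sparse_subsequence:
  assumes z: "\<And>n. cmod (z n) < 1" and lim: "(\<lambda>n. cmod (z n)) \<longlonglongrightarrow> 1"
  obtains r :: "nat \<Rightarrow> nat" where "strict_mono r"
    "\<And>j k. j < k \<Longrightarrow> 1 - (1/4) ^ k \<le> cmod (Moebius_function 0 (z (r j)) (z (r k)))"
proof -
  \<comment> \<open>The condition is imposed at all indices up to \<open>r n\<close>, not only at the chosen ones, so that the
      next choice depends on \<open>r n\<close> alone.\<close>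
  define Q where "Q = (\<lambda>n x y. x < (y::nat) \<and>
      (\<forall>i\<le>x. 1 - (1/4) ^ Suc n \<le> cmod (Moebius_function 0 (z i) (z y))))"
  have "\<exists>y. True \<and> Q n x y" for n x
  proof -
    have "\<forall>\<^sub>F y in sequentially. 1 - (1/4) ^ Suc n < cmod (Moebius_function 0 (z i) (z y))" for i
      by (rule order_tendstoD(1)[OF norm_Moebius_tendsto_1[OF z z lim]]) simp
    hence "\<forall>\<^sub>F y in sequentially. \<forall>i\<in>{..x}. 1 - (1/4) ^ Suc n < cmod (Moebius_function 0 (z i) (z y))"
      by (intro eventually_ball_finite) auto
    hence "\<forall>\<^sub>F y in sequentially. Q n x y"
      using eventually_gt_at_top[of x] by eventually_elim (auto simp: Q_def intro: less_imp_le)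
    thus ?thesis by (auto simp: eventually_sequentially)
  qed
  then obtain r where r: "\<And>n. Q n (r n) (r (Suc n))"
    using dependent_nat_choice[of "\<lambda>_ _. True" Q] by blast
  have mono: "strict_mono r"
    using r by (simp add: Q_def strict_mono_Suc_iff)
  show thesis
  proof (rule that[OF mono])
    fix j k :: nat assume "j < k"
    then obtain m where m: "k = Suc m" "j \<le> m"
      by (metis less_Suc_eq_le lessE less_imp_Suc_add le_add1)
    hence "r j \<le> r m" using mono by (simp add: strict_mono_less_eq)
    thus "1 - (1/4) ^ k \<le> cmod (Moebius_function 0 (z (r j)) (z (r k)))"
      using r[of m] m by (auto simp: Q_def)
  qed
qed

text \<open>
  Of the infinite Blaschke product only the bound by 1 and the lower bounds on the weight at the
  zeros are needed, and these pass to any locally uniform limit of a subsequence of its partial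
  products.
\<close>

lemma exists_bounded_with_bloch_weight_tendsto_1:
  assumes z: "\<And>n. cmod (z n) < 1" and lim: "(\<lambda>n. cmod (z n)) \<longlonglongrightarrow> 1"
  obtains B and r :: "nat \<Rightarrow> nat" where "B holomorphic_on \<DD>" "\<And>w. w \<in> \<DD> \<Longrightarrow> cmod (B w) \<le> 1"
    "strict_mono r" "(\<lambda>n. bloch_weight B (z (r n))) \<longlonglongrightarrow> 1"
proof -
  obtain r :: "nat \<Rightarrow> nat" where r: "strict_mono r"
    and sparse: "\<And>j k. j < k \<Longrightarrow> 1 - (1/4) ^ k \<le> cmod (Moebius_function 0 (z (r j)) (z (r k)))"
    using sparse_subsequence[OF z lim] by blast
  define P where "P N w = (\<Prod>k<N. Moebius_function 0 (z (r k)) w)" for N w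
  define H where "H = {h. h holomorphic_on \<DD> \<and> (\<forall>w\<in>\<DD>. cmod (h w) \<le> 1)}"
  have PH: "P N \<in> H" for N
  proof -
    have "P N holomorphic_on \<DD>"
      unfolding P_def by (intro holomorphic_on_prod Moebius_function_holomorphic z)
    moreover have "cmod (P N w) \<le> 1" if "w \<in> \<DD>" for w
      using Moebius_function_norm_lt_1[OF z, of w 0] that
      unfolding P_def prod_norm[symmetric] by (intro prod_le_1) (auto intro: less_imp_le)
    ultimately show ?thesis by (simp add: H_def)
  qed
  obtain B s where B: "B holomorphic_on \<DD>" and s: "strict_mono (s :: nat \<Rightarrow> nat)"
    and pt: "\<And>x. x \<in> \<DD> \<Longrightarrow> (\<lambda>n. P (s n) x) \<longlonglongrightarrow> B x"
    and ul: "\<And>K. compact K \<Longrightarrow> K \<subseteq> \<DD> \<Longrightarrow> uniform_limit K (P \<circ> s) B sequentially"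
  proof (rule Montel[of \<DD> H P])
    show "\<exists>b. \<forall>h\<in>H. \<forall>w\<in>K. cmod (h w) \<le> b" if "compact K" "K \<subseteq> \<DD>" for K
      using that by (intro exI[of _ 1]) (auto simp: H_def)
  qed (use PH in \<open>auto simp: H_def\<close>)
  have B1: "cmod (B w) \<le> 1" if "w \<in> \<DD>" for w
    by (rule Lim_bounded[OF tendsto_norm[OF pt[OF that]], of 0])
      (use PH that in \<open>auto simp: H_def\<close>)
  have low: "1 - 2 * (1/2) ^ n \<le> bloch_weight B (z (r n))" for n
  proof -
    define t where "t = (cmod (z (r n)) + 1) / 2"
    have t: "cmod (z (r n)) < t" "t < 1" using z[of "r n"] by (auto simp: t_def)
    have "uniform_limit (ball 0 t) (P \<circ> s) B sequentially"
      by (rule uniform_limit_on_subset[OF ul[of "cball 0 t"]]) (use t in auto)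
    hence "(\<lambda>m. deriv ((P \<circ> s) m) (z (r n))) \<longlonglongrightarrow> deriv B (z (r n))"
    proof (rule deriv_complex_uniform_limit)
      show "\<forall>\<^sub>F m in sequentially. (P \<circ> s) m holomorphic_on ball 0 t"
      proof (intro always_eventually allI)
        fix m
        have "P (s m) holomorphic_on \<DD>" using PH by (simp add: H_def)
        thus "(P \<circ> s) m holomorphic_on ball 0 t"
          using t by (auto intro: holomorphic_on_subset)
      qed
    qed (use t in auto)
    hence "(\<lambda>m. bloch_weight (P (s m)) (z (r n))) \<longlonglongrightarrow> bloch_weight B (z (r n))"
      unfolding bloch_weight_def comp_def by (intro tendsto_intros)
    moreover have "1 - 2 * (1/2) ^ n \<le> bloch_weight (P (s m)) (z (r n))" if "m \<ge> Suc n" for m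
    proof -
      have "n < s m" using seq_suble[OF s, of m] that by simp
      thus ?thesis
        unfolding P_def
        using bloch_weight_finite_Blaschke_lower[of "\<lambda>k. z (r k)" n "s m"] z sparse by simp
    qed
    ultimately show ?thesis by (intro Lim_bounded2[of _ _ "Suc n"]) auto
  qed
  have "(\<lambda>n. bloch_weight B (z (r n))) \<longlonglongrightarrow> 1"
  proof (rule tendsto_sandwich)
    have "(\<lambda>n. 1 - 2 * (1/2 :: real) ^ n) \<longlonglongrightarrow> 1 - 2 * 0"
      by (intro tendsto_intros LIMSEQ_power_zero) simp
    thus "(\<lambda>n. 1 - 2 * (1/2 :: real) ^ n) \<longlonglongrightarrow> 1" by simp
    show "\<forall>\<^sub>F n in sequentially. bloch_weight B (z (r n)) \<le> 1"
      using z by (intro always_eventually allI bloch_weight_le_1[OF B B1]) auto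
  qed (use low in auto)
  with B B1 r show thesis by (rule that)
qed

section \<open>Sequences along which the modulus approaches its supremum\<close>

lemma bdd_above_norm_H_infinity:
  assumes "g \<in> H_infinity"
  shows "bdd_above ((\<lambda>w. cmod (g w)) ` \<DD>)"
  using assms unfolding H_infinity_def bounded_iff bdd_above_def by auto

lemma H_infinity_norm_le_SUP:
  assumes "g \<in> H_infinity" "z \<in> \<DD>"
  shows "cmod (g z) \<le> (SUP w\<in>\<DD>. cmod (g w))"
  by (rule cSUP_upper[OF assms(2) bdd_above_norm_H_infinity[OF assms(1)]])

lemma exists_boundary_sequence_tendsto_SUP:
  assumes g: "g \<in> H_infinity"
  obtains z :: "nat \<Rightarrow> complex" where "\<And>n. z n \<in> \<DD>" "(\<lambda>n. cmod (z n)) \<longlonglongrightarrow> 1"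
    "(\<lambda>n. cmod (g (z n))) \<longlonglongrightarrow> (SUP w\<in>\<DD>. cmod (g w))"
proof -
  let ?M = "SUP w\<in>\<DD>. cmod (g w)"
  have hol: "g holomorphic_on \<DD>" using g by (simp add: H_infinity_def)
  \<comment> \<open>Otherwise \<open>|g| \<le> M - e\<close> on a circle enclosing a point where \<open>|g| > M - e\<close>.\<close>
  have ex: "\<exists>z\<in>\<DD>. 1 - e < cmod z \<and> ?M - e < cmod (g z)" if e: "0 < e" for e
  proof (rule ccontr)
    assume neg: "\<not> ?thesis"
    obtain w where w: "w \<in> \<DD>" "?M - e < cmod (g w)"
      using less_cSUP_iff[OF _ bdd_above_norm_H_infinity[OF g], of "?M - e"] e by auto
    obtain t where t: "max (cmod w) (1 - e) < t" "t < 1"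
      using w e dense[of "max (cmod w) (1 - e)" 1] by auto
    have "0 < t" using t norm_ge_zero[of w] by linarith
    have sub: "cball 0 t \<subseteq> \<DD>" using t by auto
    have "cmod (g w) \<le> ?M - e"
    proof (rule maximum_modulus_frontier[of g "cball 0 t"])
      show "g holomorphic_on interior (cball 0 t)"
        using sub interior_subset by (intro holomorphic_on_subset[OF hol]) blast
      show "continuous_on (closure (cball 0 t)) g"
        using sub by (intro holomorphic_on_imp_continuous_on holomorphic_on_subset[OF hol]) simp
      show "cmod (g x) \<le> ?M - e" if "x \<in> frontier (cball 0 t)" for x
      proof -
        have "cmod x = t" using that \<open>0 < t\<close> by (simp add: frontier_cball)
        with t neg show ?thesis by force
      qed
    qed (use t in auto)
    with w show False by simp
  qed
  have "\<forall>n. \<exists>z\<in>\<DD>. 1 - inverse (real (Suc n)) < cmod z \<and> ?M - inverse (real (Suc n)) < cmod (g z)"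
    using ex by simp
  then obtain z where z: "\<And>n. z n \<in> \<DD>" "\<And>n. 1 - inverse (real (Suc n)) < cmod (z n)"
    "\<And>n. ?M - inverse (real (Suc n)) < cmod (g (z n))"
    by metis
  have lim: "(\<lambda>n. c - inverse (real (Suc n))) \<longlonglongrightarrow> c" for c
    using tendsto_diff[OF tendsto_const LIMSEQ_inverse_real_of_nat, of c] by simp
  show thesis
  proof (rule that[OF z(1)])
    show "(\<lambda>n. cmod (z n)) \<longlonglongrightarrow> 1"
      by (rule tendsto_sandwich[OF _ _ lim tendsto_const])
        (use z(1,2) in \<open>auto intro!: always_eventually less_imp_le\<close>)
    show "(\<lambda>n. cmod (g (z n))) \<longlonglongrightarrow> ?M"
      by (rule tendsto_sandwich[OF _ _ lim tendsto_const])
        (use z(1,3) H_infinity_norm_le_SUP[OF g] in \<open>auto intro!: always_eventually less_imp_le\<close>)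
  qed
qed

lemma norm_tendsto_1_if_tendsto_SUP:
  assumes g: "g \<in> H_infinity" and nc: "\<not> g constant_on \<DD>"
    and z: "\<And>n. z n \<in> \<DD>" and lim: "(\<lambda>n. cmod (g (z n))) \<longlonglongrightarrow> (SUP w\<in>\<DD>. cmod (g w))"
  shows "(\<lambda>n. cmod (z n)) \<longlonglongrightarrow> 1"
proof (rule order_tendstoI)
  let ?M = "SUP w\<in>\<DD>. cmod (g w)"
  have hol: "g holomorphic_on \<DD>" using g by (simp add: H_infinity_def)
  fix b :: real assume "b < 1"
  \<comment> \<open>\<open>b\<close> may be negative, but the closed disc of radius \<open>t\<close> must not be empty.\<close>
  define t where "t = max 0 b"
  have t: "0 \<le> t" "b \<le> t" "t < 1" using \<open>b < 1\<close> by (auto simp: t_def)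
  have sub: "cball 0 t \<subseteq> \<DD>" using t by auto
  have "continuous_on (cball 0 t) (\<lambda>w. cmod (g w))"
    by (intro continuous_on_norm holomorphic_on_imp_continuous_on holomorphic_on_subset[OF hol] sub)
  then obtain \<xi> where \<xi>: "\<xi> \<in> cball 0 t" "\<And>w. w \<in> cball 0 t \<Longrightarrow> cmod (g w) \<le> cmod (g \<xi>)"
    using continuous_attains_sup[of "cball 0 t" "\<lambda>w. cmod (g w)"] t by auto
  have "cmod (g \<xi>) \<noteq> ?M"
  proof
    assume "cmod (g \<xi>) = ?M"
    hence "g constant_on \<DD>"
      using \<xi>(1) sub H_infinity_norm_le_SUP[OF g]
      by (intro maximum_modulus_principle[OF hol, of \<DD> \<xi>]) (auto simp: subset_iff)
    with nc show False by contradiction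
  qed
  hence "cmod (g \<xi>) < ?M"
    using H_infinity_norm_le_SUP[OF g, of \<xi>] \<xi>(1) sub by fastforce
  from order_tendstoD(1)[OF lim this] show "\<forall>\<^sub>F n in sequentially. b < cmod (z n)"
  proof eventually_elim
    case (elim n)
    hence "z n \<notin> cball 0 t" using \<xi>(2)[of "z n"] by auto
    thus ?case using t by simp
  qed
next
  fix b :: real assume "1 < b"
  have "cmod (z n) < b" for n using z[of n] \<open>1 < b\<close> by simp
  thus "\<forall>\<^sub>F n in sequentially. cmod (z n) < b" by simp
qed

section \<open>The operator on the Bloch space\<close>

lemma integral_op_add:
  assumes "f holomorphic_on \<DD>" "h holomorphic_on \<DD>" "g holomorphic_on \<DD>" "z \<in> \<DD>"
  shows "integral_op g (\<lambda>x. f x + h x) z = integral_op g f z + integral_op g h z"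
proof -
  have sub: "path_image (linepath 0 z) \<subseteq> \<DD>"
    using assms(4) by (simp add: closed_segment_subset)
  have int: "(\<lambda>w. deriv k w * g w) contour_integrable_on linepath 0 z" if "k holomorphic_on \<DD>" for k
    by (rule contour_integrable_holomorphic_simple[OF _ open_ball valid_path_linepath sub])
      (intro holomorphic_on_mult holomorphic_deriv that assms open_ball)
  have "integral_op g (\<lambda>x. f x + h x) z
      = contour_integral (linepath 0 z) (\<lambda>w. deriv f w * g w + deriv h w * g w)"
    unfolding integral_op_def using sub
    by (intro contour_integral_eq) (simp add: deriv_disc_add[OF assms(1,2) subsetD[OF sub]] algebra_simps)
  thus ?thesis
    by (simp add: contour_integral_add int assms integral_op_def)
qed

lemma integral_op_scaleR:
  assumes "f holomorphic_on \<DD>" "g holomorphic_on \<DD>" "z \<in> \<DD>"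
  shows "integral_op g (\<lambda>x. c *\<^sub>R f x) z = c *\<^sub>R integral_op g f z"
proof -
  have sub: "path_image (linepath 0 z) \<subseteq> \<DD>"
    using assms(3) by (simp add: closed_segment_subset)
  have int: "(\<lambda>w. deriv f w * g w) contour_integrable_on linepath 0 z"
    by (rule contour_integrable_holomorphic_simple[OF _ open_ball valid_path_linepath sub])
      (intro holomorphic_on_mult holomorphic_deriv assms open_ball)
  have d: "deriv (\<lambda>x. of_real c * f x) w = of_real c * deriv f w" if "w \<in> \<DD>" for w
    by (rule deriv_cmult[OF holomorphic_on_imp_differentiable_at[OF assms(1) open_ball that]])
  have "integral_op g (\<lambda>x. c *\<^sub>R f x) z
      = contour_integral (linepath 0 z) (\<lambda>w. of_real c * (deriv f w * g w))"
    unfolding integral_op_def scaleR_conv_of_real using sub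
    by (intro contour_integral_eq) (simp add: d[OF subsetD[OF sub]])
  thus ?thesis
    by (simp add: contour_integral_lmul int integral_op_def scaleR_conv_of_real)
qed

lemma bloch_weight_bloch_op:
  assumes g: "g \<in> H_infinity" and z: "z \<in> \<DD>"
  shows "bloch_weight (bloch_fun (bloch_op g f)) z = bloch_weight (bloch_fun f) z * cmod (g z)"
proof -
  have "g holomorphic_on \<DD>" using g by (simp add: H_infinity_def)
  note D = integral_op_has_field_derivative[OF bloch_fun_props(1) this z, of f]
  have "bloch_weight (bloch_fun (bloch_op g f)) z = bloch_weight (integral_op g (bloch_fun f)) z"
    unfolding bloch_fun_bloch_op[OF g] by (rule bloch_weight_cong) (use z in \<open>auto simp: disc_restrict_def\<close>)
  thus ?thesis using DERIV_imp_deriv[OF D] by (simp add: bloch_weight_def norm_mult)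
qed

lemma norm_bloch_op:
  assumes g: "g \<in> H_infinity"
  shows "norm (bloch_op g f) = (SUP z\<in>\<DD>. bloch_weight (bloch_fun f) z * cmod (g z))"
proof -
  have "bloch_fun (bloch_op g f) 0 = 0"
    by (simp add: bloch_fun_bloch_op[OF g] disc_restrict_def integral_op_def)
  thus ?thesis
    unfolding norm_bloch_def bloch_fun_norm_def
    by (auto intro!: SUP_cong simp: bloch_weight_bloch_op[OF g])
qed

lemma bloch_weight_le_norm:
  assumes "z \<in> \<DD>"
  shows "bloch_weight (bloch_fun f) z \<le> norm f"
  unfolding norm_bloch_def bloch_fun_norm_def
  using bloch_weight_le_Sup[OF assms, of f] norm_ge_zero[of "bloch_fun f 0"] by linarith

lemma norm_bloch_op_le:
  assumes g: "g \<in> H_infinity"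
  shows "norm (bloch_op g f) \<le> norm f * (SUP w\<in>\<DD>. cmod (g w))"
  unfolding norm_bloch_op[OF g]
  by (intro cSUP_least mult_mono bloch_weight_le_norm H_infinity_norm_le_SUP[OF g]) auto

lemma bloch_weight_mult_le_norm_bloch_op:
  assumes g: "g \<in> H_infinity" and z: "z \<in> \<DD>"
  shows "bloch_weight (bloch_fun f) z * cmod (g z) \<le> norm (bloch_op g f)"
  using bloch_weight_le_norm[OF z, of "bloch_op g f"] by (simp add: bloch_weight_bloch_op[OF g z])

lemma bounded_linear_bloch_op:
  assumes g: "g \<in> H_infinity"
  shows "bounded_linear (bloch_op g)"
proof (rule bounded_linear_intro)
  have hol: "g holomorphic_on \<DD>" using g by (simp add: H_infinity_def)
  show "bloch_op g (f + h) = bloch_op g f + bloch_op g h" for f h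
    by (rule iffD1[OF bloch_fun_inject])
      (auto simp: bloch_fun_bloch_op[OF g] plus_bloch.rep_eq disc_restrict_def
        integral_op_add bloch_fun_props hol)
  show "bloch_op g (c *\<^sub>R f) = c *\<^sub>R bloch_op g f" for c f
    by (rule iffD1[OF bloch_fun_inject])
      (auto simp: bloch_fun_bloch_op[OF g] scaleR_bloch.rep_eq disc_restrict_def
        integral_op_scaleR[unfolded scaleR_conv_of_real] scaleR_conv_of_real bloch_fun_props hol)
  show "norm (bloch_op g f) \<le> norm f * (SUP w\<in>\<DD>. cmod (g w))" for f
    by (rule norm_bloch_op_le[OF g])
qed

lemma norm_bloch_op_eq_SUP_if_sequence:
  assumes g: "g \<in> H_infinity" and f: "norm f = 1" and z: "\<And>n. z n \<in> \<DD>"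
    and gz: "(\<lambda>n. cmod (g (z n))) \<longlonglongrightarrow> (SUP w\<in>\<DD>. cmod (g w))"
    and fz: "(\<lambda>n. bloch_weight (bloch_fun f) (z n)) \<longlonglongrightarrow> 1"
  shows "norm (bloch_op g f) = (SUP w\<in>\<DD>. cmod (g w))"
proof (rule antisym)
  show "norm (bloch_op g f) \<le> (SUP w\<in>\<DD>. cmod (g w))"
    using norm_bloch_op_le[OF g, of f] f by simp
  have "(\<lambda>n. bloch_weight (bloch_fun f) (z n) * cmod (g (z n))) \<longlonglongrightarrow> 1 * (SUP w\<in>\<DD>. cmod (g w))"
    by (intro tendsto_mult fz gz)
  thus "(SUP w\<in>\<DD>. cmod (g w)) \<le> norm (bloch_op g f)"
    using Lim_bounded[of _ _ 0 "norm (bloch_op g f)"] bloch_weight_mult_le_norm_bloch_op[OF g z]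
    by simp
qed

lemma exists_norm_one_with_bloch_weight_tendsto_1:
  assumes z: "\<And>n. z n \<in> \<DD>" and lim: "(\<lambda>n. cmod (z n)) \<longlonglongrightarrow> 1"
  obtains f :: bloch and r :: "nat \<Rightarrow> nat" where "norm f = 1" "strict_mono r"
    "(\<lambda>n. bloch_weight (bloch_fun f) (z (r n))) \<longlonglongrightarrow> 1"
proof -
  have "cmod (z n) < 1" for n using z[of n] by simp
  then obtain B and r :: "nat \<Rightarrow> nat" where B: "B holomorphic_on \<DD>"
    and B1: "\<And>w. w \<in> \<DD> \<Longrightarrow> cmod (B w) \<le> 1" and r: "strict_mono r"
    and BL: "(\<lambda>n. bloch_weight B (z (r n))) \<longlonglongrightarrow> 1"
    using exists_bounded_with_bloch_weight_tendsto_1[OF _ lim] by blast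
  \<comment> \<open>The Bloch norm also counts \<open>|B 0|\<close>, which is removed without changing the derivative.\<close>
  define h where "h w = B w - B 0" for w
  have hol: "h holomorphic_on \<DD>" unfolding h_def by (intro holomorphic_intros B)
  have wh: "bloch_weight h w = bloch_weight B w" if "w \<in> \<DD>" for w
  proof -
    have "(h has_field_derivative deriv B w - 0) (at w)"
      unfolding h_def
      by (intro DERIV_diff DERIV_const holomorphic_derivI[OF B open_ball that])
    thus ?thesis by (simp add: bloch_weight_def DERIV_imp_deriv)
  qed
  have w1: "bloch_weight h w \<le> 1" if "w \<in> \<DD>" for w
    using wh bloch_weight_le_1[OF B B1] that by simp
  define f where "f = Abs_bloch (disc_restrict h)"
  have fun_f: "bloch_fun f = disc_restrict h"
    unfolding f_def by (rule bloch_fun_Abs_bloch_restrict[OF hol]) (rule bdd_aboveI2, rule w1)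
  have wf: "bloch_weight (bloch_fun f) w = bloch_weight B w" if "w \<in> \<DD>" for w
    unfolding fun_f wh[OF that, symmetric]
    by (rule bloch_weight_cong) (use that in \<open>auto simp: disc_restrict_def\<close>)
  have fL: "(\<lambda>n. bloch_weight (bloch_fun f) (z (r n))) \<longlonglongrightarrow> 1"
    using BL wf z by simp
  have "norm f = (SUP w\<in>\<DD>. bloch_weight (bloch_fun f) w)"
    by (simp add: norm_bloch_def bloch_fun_norm_def fun_f disc_restrict_def h_def)
  also have "\<dots> \<le> 1"
    using w1 wh wf by (intro cSUP_least) auto
  finally have "norm f \<le> 1" .
  moreover have "1 \<le> norm f"
    using Lim_bounded[OF fL] bloch_weight_le_norm z by blast
  ultimately show thesis using that r fL by (metis antisym)
qed

lemma exists_norm_one_attaining_SUP: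
  assumes g: "g \<in> H_infinity"
  obtains f :: bloch where "norm f = 1" "norm (bloch_op g f) = (SUP w\<in>\<DD>. cmod (g w))"
proof -
  obtain z :: "nat \<Rightarrow> complex" where z: "\<And>n. z n \<in> \<DD>" "(\<lambda>n. cmod (z n)) \<longlonglongrightarrow> 1"
    and gz: "(\<lambda>n. cmod (g (z n))) \<longlonglongrightarrow> (SUP w\<in>\<DD>. cmod (g w))"
    using exists_boundary_sequence_tendsto_SUP[OF g] by blast
  obtain f :: bloch and r :: "nat \<Rightarrow> nat" where f: "norm f = 1" and r: "strict_mono r"
    and fz: "(\<lambda>n. bloch_weight (bloch_fun f) (z (r n))) \<longlonglongrightarrow> 1"
    using exists_norm_one_with_bloch_weight_tendsto_1[OF z] by blast
  have "norm (bloch_op g f) = (SUP w\<in>\<DD>. cmod (g w))"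
    using LIMSEQ_subseq_LIMSEQ[OF gz r] z
    by (intro norm_bloch_op_eq_SUP_if_sequence[OF g f _ _ fz]) (auto simp: comp_def)
  with f show thesis by (rule that)
qed

lemma onorm_bloch_op:
  assumes g: "g \<in> H_infinity"
  shows "onorm (bloch_op g) = (SUP w\<in>\<DD>. cmod (g w))"
proof (rule antisym)
  have "0 \<le> (SUP w\<in>\<DD>. cmod (g w))"
    using order_trans[OF norm_ge_zero H_infinity_norm_le_SUP[OF g, of 0]] by simp
  thus "onorm (bloch_op g) \<le> (SUP w\<in>\<DD>. cmod (g w))"
    using norm_bloch_op_le[OF g] by (intro onorm_bound) (auto simp: mult.commute)
  obtain f :: bloch where "norm f = 1" "norm (bloch_op g f) = (SUP w\<in>\<DD>. cmod (g w))"
    using exists_norm_one_attaining_SUP[OF g] by blast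
  thus "(SUP w\<in>\<DD>. cmod (g w)) \<le> onorm (bloch_op g)"
    using onorm[OF bounded_linear_bloch_op[OF g], of f] by simp
qed

text \<open>
  If \<open>0 \<le> w\<^sub>n \<le> 1\<close>, \<open>0 \<le> c\<^sub>n \<le> M\<close> and \<open>M > 0\<close>, then \<open>w\<^sub>n c\<^sub>n \<rightarrow> M\<close> forces both factors to
  their upper bounds, because \<open>w\<^sub>n c\<^sub>n \<le> c\<^sub>n\<close> and \<open>w\<^sub>n c\<^sub>n / M \<le> w\<^sub>n\<close>.
\<close>

lemma mult_tendsto_max_imp_factors:
  fixes w c :: "nat \<Rightarrow> real"
  assumes w: "\<And>n. 0 \<le> w n" "\<And>n. w n \<le> 1" and c: "\<And>n. 0 \<le> c n" "\<And>n. c n \<le> M" and M: "0 < M"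
    and lim: "(\<lambda>n. w n * c n) \<longlonglongrightarrow> M"
  shows "c \<longlonglongrightarrow> M" "w \<longlonglongrightarrow> 1"
proof -
  show "c \<longlonglongrightarrow> M"
    by (rule tendsto_sandwich[OF _ _ lim tendsto_const])
      (use w c in \<open>auto intro!: always_eventually mult_left_le_one_le\<close>)
  have lim': "(\<lambda>n. w n * c n / M) \<longlonglongrightarrow> 1"
    using tendsto_divide[OF lim tendsto_const, of M] M by simp
  show "w \<longlonglongrightarrow> 1"
    by (rule tendsto_sandwich[OF _ _ lim' tendsto_const])
      (use w c M in \<open>auto intro!: always_eventually mult_left_mono simp: divide_le_eq\<close>)
qed

lemma exists_sequence_if_norm_bloch_op_eq_SUP:
  assumes g: "g \<in> H_infinity" and nc: "\<not> g constant_on \<DD>" and f: "norm f = 1"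
    and max: "norm (bloch_op g f) = (SUP w\<in>\<DD>. cmod (g w))"
  obtains z :: "nat \<Rightarrow> complex" where "\<And>n. z n \<in> \<DD>" "(\<lambda>n. cmod (z n)) \<longlonglongrightarrow> 1"
    "(\<lambda>n. cmod (g (z n))) \<longlonglongrightarrow> (SUP w\<in>\<DD>. cmod (g w))"
    "(\<lambda>n. bloch_weight (bloch_fun f) (z n)) \<longlonglongrightarrow> 1"
proof -
  let ?M = "SUP w\<in>\<DD>. cmod (g w)"
  let ?w = "bloch_weight (bloch_fun f)"
  have M: "0 < ?M"
  proof (rule ccontr)
    assume "\<not> 0 < ?M"
    hence "g w = 0" if "w \<in> \<DD>" for w
      using order_trans[OF H_infinity_norm_le_SUP[OF g that], of 0] by simp
    with nc show False by (auto simp: constant_on_def)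
  qed
  have SUP: "(SUP z\<in>\<DD>. ?w z * cmod (g z)) = ?M"
    using max norm_bloch_op[OF g] by simp
  have bdd: "bdd_above ((\<lambda>z. ?w z * cmod (g z)) ` \<DD>)"
    by (rule bdd_aboveI2[OF bloch_weight_mult_le_norm_bloch_op[OF g]])
  have "\<exists>z\<in>\<DD>. ?M - inverse (real (Suc n)) < ?w z * cmod (g z)" for n
    using less_cSUP_iff[OF _ bdd, of "?M - inverse (real (Suc n))"] unfolding SUP by auto
  then obtain z where z: "\<And>n. z n \<in> \<DD>"
    "\<And>n. ?M - inverse (real (Suc n)) < ?w (z n) * cmod (g (z n))"
    by metis
  have le: "?w (z n) * cmod (g (z n)) \<le> ?M" for n
    using bloch_weight_mult_le_norm_bloch_op[OF g z(1), of f] max by simp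
  have "(\<lambda>n. ?M - inverse (real (Suc n))) \<longlonglongrightarrow> ?M - 0"
    by (intro tendsto_diff tendsto_const LIMSEQ_inverse_real_of_nat)
  hence lim0: "(\<lambda>n. ?M - inverse (real (Suc n))) \<longlonglongrightarrow> ?M" by simp
  have lim: "(\<lambda>n. ?w (z n) * cmod (g (z n))) \<longlonglongrightarrow> ?M"
    by (rule tendsto_sandwich[OF _ _ lim0 tendsto_const])
      (use z(2) le in \<open>auto intro!: always_eventually less_imp_le\<close>)
  have w1: "?w (z n) \<le> 1" for n
    using bloch_weight_le_norm[OF z(1), of f] f by simp
  note both = mult_tendsto_max_imp_factors[OF bloch_weight_nonneg[OF z(1)] w1 norm_ge_zero
      H_infinity_norm_le_SUP[OF g z(1)] M lim]
  show thesis
    by (rule that[OF z(1) norm_tendsto_1_if_tendsto_SUP[OF g nc z(1) both(1)] both])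
qed

section \<open>Norm attainment and extremal functions\<close>

theorem theorem2:
  fixes g :: "complex \<Rightarrow> complex"
  assumes "g \<in> H_infinity"
  shows "norm_attaining (bloch_op g) \<and>
    (\<not> g constant_on \<DD> \<longrightarrow>
      (\<forall>f :: bloch. norm f = 1 \<longrightarrow>
        (extremal (bloch_op g) f \<longleftrightarrow>
          (\<exists>z :: nat \<Rightarrow> complex.
            (\<forall>n. z n \<in> \<DD>) \<and>
            (\<lambda>n. cmod (z n)) \<longlonglongrightarrow> 1 \<and>
            (\<lambda>n. cmod (g (z n))) \<longlonglongrightarrow> (SUP w\<in>\<DD>. cmod (g w)) \<and>
            (\<lambda>n. (1 - (cmod (z n))\<^sup>2) * cmod (deriv (bloch_fun f) (z n))) \<longlonglongrightarrow> 1))))"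
  unfolding bloch_weight_def[symmetric]
proof (intro conjI impI allI iffI)
  note g = assms
  obtain f :: bloch where "norm f = 1" "norm (bloch_op g f) = (SUP w\<in>\<DD>. cmod (g w))"
    using exists_norm_one_attaining_SUP[OF g] by blast
  thus "norm_attaining (bloch_op g)"
    unfolding norm_attaining_def extremal_def onorm_bloch_op[OF g]
    using bounded_linear_bloch_op[OF g] by blast
next
  fix f :: bloch
  assume nc: "\<not> g constant_on \<DD>" and f: "norm f = 1" and ext: "extremal (bloch_op g) f"
  have "norm (bloch_op g f) = (SUP w\<in>\<DD>. cmod (g w))"
    using ext by (simp add: extremal_def onorm_bloch_op[OF assms])
  then show "\<exists>z. (\<forall>n. z n \<in> \<DD>) \<and> (\<lambda>n. cmod (z n)) \<longlonglongrightarrow> 1 \<and>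
      (\<lambda>n. cmod (g (z n))) \<longlonglongrightarrow> (SUP w\<in>\<DD>. cmod (g w)) \<and>
      (\<lambda>n. bloch_weight (bloch_fun f) (z n)) \<longlonglongrightarrow> 1"
    using exists_sequence_if_norm_bloch_op_eq_SUP[OF assms nc f] by metis
next
  fix f :: bloch
  assume f: "norm f = 1" and "\<exists>z. (\<forall>n. z n \<in> \<DD>) \<and> (\<lambda>n. cmod (z n)) \<longlonglongrightarrow> 1 \<and>
      (\<lambda>n. cmod (g (z n))) \<longlonglongrightarrow> (SUP w\<in>\<DD>. cmod (g w)) \<and>
      (\<lambda>n. bloch_weight (bloch_fun f) (z n)) \<longlonglongrightarrow> 1"
  then show "extremal (bloch_op g) f"
    using norm_bloch_op_eq_SUP_if_sequence[OF assms f]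
    unfolding extremal_def onorm_bloch_op[OF assms] by blast
qed

end
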